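(* Let $1\le p\le q\le\infty$. Then there is no essentially isolated point in $\mathbf{V}(\mathcal{F}_p,\mathcal{F}_q)$: for every bounded $V_g\in\mathbf{V}(\mathcal{F}_p,\mathcal{F}_q)$ and every $r>0$ there exists $V_{g_1}\in\mathbf{V}(\mathcal{F}_p,\mathcal{F}_q)$ with $V_{g_1}\neq V_g$ and $\|V_g-V_{g_1}\|_e<r$.
   Context: For $0<p<\infty$, the Fock space $\mathcal{F}_p$ consists of entire functions $f$ on $\mathbb{C}$ with $\|f\|_p^p=\frac{p}{2\pi}\int_{\mathbb{C}}|f(z)|^pe^{-\frac p2|z|^2}\,dA(z)<\infty$, where $dA$ is Lebesgue area measure; $\mathcal{F}_\infty$ consists of entire $f$ with $\|f\|_\infty=\sup_{z\in\mathbb{C}}|f(z)|e^{-\frac12|z|^2}<\infty$. For an entire function $g$, the Volterra-type integral operator is $V_gf(z)=\int_0^z f(w)g'(w)\,dw$. $\mathbf{V}(\mathcal{F}_p,\mathcal{F}_q)$ denotes the set of all bounded operators $V_g:\mathcal{F}_p\to\mathcal{F}_q$ ($g$ entire). The essential norm of a bounded operator $T:\mathcal{F}_p\to\mathcal{F}_q$ is $\|T\|_e=\inf\{\|T-K\|: K \text{ compact}\}$; an operator is essentially isolated in $\mathbf{V}(\mathcal{F}_p,\mathcal{F}_q)$ if it is isolated with respect to the topology induced by $(S,T)\mapsto\|S-T\|_e$. *)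

theory Defs
  imports "HOL-Complex_Analysis.Complex_Analysis"
begin

definition fock_norm :: "ereal \<Rightarrow> (complex \<Rightarrow> complex) \<Rightarrow> ennreal" where
  "fock_norm p f =
     (if p = \<infinity> then (SUP z. ennreal (cmod (f z) * exp (- (cmod z)\<^sup>2 / 2)))
      else (let pr = real_of_ereal p;
                I = ennreal (pr / (2 * pi)) *
                    (\<integral>\<^sup>+ z. ennreal (cmod (f z) powr pr * exp (- pr / 2 * (cmod z)\<^sup>2)) \<partial>lborel)
            in if I = \<infinity> then \<infinity> else ennreal (enn2real I powr (1 / pr))))"

definition fock_space :: "ereal \<Rightarrow> (complex \<Rightarrow> complex) set" where
  "fock_space p = {f. f holomorphic_on UNIV \<and> fock_norm p f < \<infinity>}"

definition op_norm :: "ereal \<Rightarrow> ereal \<Rightarrow> ((complex \<Rightarrow> complex) \<Rightarrow> (complex \<Rightarrow> complex)) \<Rightarrow> ennreal" where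
  "op_norm p q T = (SUP f \<in> {f \<in> fock_space p. fock_norm p f \<le> 1}. fock_norm q (T f))"

definition linear_on_fock :: "ereal \<Rightarrow> ((complex \<Rightarrow> complex) \<Rightarrow> (complex \<Rightarrow> complex)) \<Rightarrow> bool" where
  "linear_on_fock p T \<longleftrightarrow>
     (\<forall>f \<in> fock_space p. \<forall>g \<in> fock_space p. T (\<lambda>z. f z + g z) = (\<lambda>z. T f z + T g z)) \<and>
     (\<forall>f \<in> fock_space p. \<forall>c::complex. T (\<lambda>z. c * f z) = (\<lambda>z. c * T f z))"

definition compact_op :: "ereal \<Rightarrow> ereal \<Rightarrow> ((complex \<Rightarrow> complex) \<Rightarrow> (complex \<Rightarrow> complex)) \<Rightarrow> bool" where
  "compact_op p q K \<longleftrightarrow>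
     linear_on_fock p K \<and> (\<forall>f \<in> fock_space p. K f \<in> fock_space q) \<and>
     (\<forall>s :: nat \<Rightarrow> complex \<Rightarrow> complex.
        (\<forall>n. s n \<in> fock_space p \<and> fock_norm p (s n) \<le> 1) \<longrightarrow>
        (\<exists>h \<in> fock_space q. \<exists>\<sigma>. strict_mono \<sigma> \<and>
            (\<lambda>n. fock_norm q (\<lambda>z. K (s (\<sigma> n)) z - h z)) \<longlonglongrightarrow> 0))"

definition ess_norm :: "ereal \<Rightarrow> ereal \<Rightarrow> ((complex \<Rightarrow> complex) \<Rightarrow> (complex \<Rightarrow> complex)) \<Rightarrow> ennreal" where
  "ess_norm p q T = (INF K \<in> {K. compact_op p q K}. op_norm p q (\<lambda>f z. T f z - K f z))"

definition volterra :: "(complex \<Rightarrow> complex) \<Rightarrow> (complex \<Rightarrow> complex) \<Rightarrow> (complex \<Rightarrow> complex)" where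
  "volterra g f = (\<lambda>z. contour_integral (linepath 0 z) (\<lambda>w. f w * deriv g w))"

definition bounded_volterra :: "ereal \<Rightarrow> ereal \<Rightarrow> (complex \<Rightarrow> complex) \<Rightarrow> bool" where
  "bounded_volterra p q g \<longleftrightarrow>
     g holomorphic_on UNIV \<and> (\<forall>f \<in> fock_space p. volterra g f \<in> fock_space q) \<and>
     op_norm p q (volterra g) < \<infinity>"

end

theory Submission
  imports Defs
begin

text \<open>Taking \<open>K = 0\<close> in the essential norm, it suffices to perturb \<open>V\<^sub>g\<close> by a small multiple of a nonzero
  bounded Volterra operator: \<open>V\<^sub>g\<close> itself if it is nonzero, and the integration operator \<open>V\<close> with symbol
  \<open>z\<close> otherwise. For the boundedness of \<open>V\<close>, write \<open>u(z) = \<bar>f(z)\<bar> exp(-\<bar>z\<bar>\<^sup>2/2)\<close> and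
  \<open>H(z) = \<integral> u(w) exp(-\<bar>z - w\<bar>) dA(w)\<close>. The mean value property gives \<open>u \<le> C H\<close>, and \<open>ln H\<close> is
  1-Lipschitz. Since \<open>\<bar>z\<bar>\<^sup>2 - \<bar>w\<bar>\<^sup>2 \<ge> \<bar>z - w\<bar>\<^sup>2\<close> for \<open>w\<close> on the segment from \<open>0\<close> to \<open>z\<close>, integrating
  along the segment yields \<open>\<bar>V f(z)\<bar> exp(-\<bar>z\<bar>\<^sup>2/2) \<le> C' H(z)\<close>. Convolution with \<open>exp(-\<bar>\<cdot>\<bar>)\<close>, which
  is bounded and integrable, maps \<open>L\<^sup>p\<close> to \<open>L\<^sup>q\<close> for \<open>p \<le> q\<close>.\<close>

section \<open>Lebesgue measure on the plane: translations, the mass of the exponential kernel,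
  rotations\<close>

lemma nn_integral_lborel_translate:
  fixes F :: "'a::euclidean_space \<Rightarrow> ennreal"
  assumes [measurable]: "F \<in> borel_measurable borel"
  shows "(\<integral>\<^sup>+ x. F (a + x) \<partial>lborel) = (\<integral>\<^sup>+ x. F x \<partial>lborel)"
proof -
  have "(\<integral>\<^sup>+ x. F x \<partial>lborel) = (\<integral>\<^sup>+ x. F x \<partial>distr lborel borel ((+) a))"
    by (simp add: lborel_distr_plus)
  also have "\<dots> = (\<integral>\<^sup>+ x. F (a + x) \<partial>lborel)"
    by (subst nn_integral_distr) auto
  finally show ?thesis by simp
qed

lemma nn_integral_exp_abs_half_finite:
  "(\<integral>\<^sup>+ x. ennreal (exp (- \<bar>x\<bar> / 2)) \<partial>lborel) < \<infinity>"
proof -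
  have lim: "((\<lambda>x::real. - 2 * exp (- x / 2)) \<longlongrightarrow> 0) at_top"
    by real_asymp
  have half: "(\<integral>\<^sup>+ x. ennreal (exp (- x / 2)) * indicator {0 ..} x \<partial>lborel) = ennreal (0 - (- 2 * exp (- 0 / 2)))"
    by (rule nn_integral_FTC_atLeast[OF _ _ _ lim]) (auto intro!: derivative_eq_intros)
  have half': "(\<integral>\<^sup>+ x. ennreal (exp (x / 2)) * indicator {.. 0} x \<partial>lborel)
      = (\<integral>\<^sup>+ x. ennreal (exp (- x / 2)) * indicator {0 ..} x \<partial>lborel)"
    by (subst nn_integral_real_affine[where c="-1" and t=0])
       (auto intro!: nn_integral_cong split: split_indicator)
  have "(\<integral>\<^sup>+ x. ennreal (exp (- \<bar>x\<bar> / 2)) \<partial>lborel)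
     \<le> (\<integral>\<^sup>+ x. ennreal (exp (- x / 2)) * indicator {0 ..} x + ennreal (exp (x / 2)) * indicator {.. 0} x \<partial>lborel)"
    by (intro nn_integral_mono) (auto split: split_indicator simp: abs_if)
  also have "\<dots> < \<infinity>"
    by (subst nn_integral_add) (auto simp: half half'[simplified] half[simplified])
  finally show ?thesis .
qed

text \<open>The average of |Re w| and |Im w| is at most |w|, so the integrand is dominated by a
  product of one-variable exponentials of rate 1/2, whose integral factors over the two
  coordinates.\<close>

lemma nn_integral_exp_norm_finite:
  "(\<integral>\<^sup>+ w. ennreal (exp (- cmod w)) \<partial>lborel) < \<infinity>"
proof -
  have "(\<integral>\<^sup>+ w. ennreal (exp (- cmod w)) \<partial>lborel)
     \<le> (\<integral>\<^sup>+ w. (\<Prod>b\<in>Basis. ennreal (exp (- \<bar>w \<bullet> b\<bar> / 2))) \<partial>(lborel :: complex measure))"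
  proof (intro nn_integral_mono)
    fix w :: complex
    have "\<bar>Re w\<bar> \<le> cmod w" "\<bar>Im w\<bar> \<le> cmod w" by (rule abs_Re_le_cmod, rule abs_Im_le_cmod)
    then have "exp (- cmod w) \<le> exp (- \<bar>Re w\<bar> / 2) * exp (- \<bar>Im w\<bar> / 2)"
      by (simp flip: exp_add)
    then show "ennreal (exp (- cmod w)) \<le> (\<Prod>b\<in>Basis. ennreal (exp (- \<bar>w \<bullet> b\<bar> / 2)))"
      by (simp add: Basis_complex_def ennreal_leI flip: ennreal_mult)
  qed
  also have "\<dots> = (\<Prod>b\<in>(Basis :: complex set). \<integral>\<^sup>+ x. ennreal (exp (- \<bar>x\<bar> / 2)) \<partial>lborel)"
    by (rule nn_integral_lborel_prod) auto
  also have "\<dots> < \<infinity>"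
    using nn_integral_exp_abs_half_finite by (simp add: Basis_complex_def ennreal_mult_less_top)
  finally show ?thesis .
qed

text \<open>A vanishing integral would force \<open>k x = 0\<close> almost everywhere and so make
  the whole space null. This is what permits division by the masses of the kernels below.\<close>

lemma nn_integral_lborel_pos:
  fixes k :: "'a::euclidean_space \<Rightarrow> real"
  assumes [measurable]: "k \<in> borel_measurable borel" and pos: "\<And>x. k x > 0"
  shows "(\<integral>\<^sup>+ x. ennreal (k x) \<partial>lborel) > 0"
proof (rule ccontr)
  assume "\<not> ?thesis"
  then have "(\<integral>\<^sup>+ x. ennreal (k x) \<partial>lborel) = 0" by simp
  then have "AE x::'a in lborel. ennreal (k x) = 0"
    by (subst (asm) nn_integral_0_iff_AE) auto
  then have "AE x::'a in lborel. False"
    by eventually_elim (metis pos ennreal_eq_0_iff not_le)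
  then have "emeasure lborel (UNIV :: 'a set) = 0"
    by (simp add: AE_iff_null null_sets_def)
  then show False by (simp)
qed

text \<open>Uniqueness of Haar measure: integrate \<open>F (c * x) * exp (- cmod y)\<close> over both variables and
  use translations only; the factor \<open>exp (- cmod y)\<close> is rotation invariant.\<close>

lemma nn_integral_lborel_rotate:
  fixes F :: "complex \<Rightarrow> ennreal"
  assumes [measurable]: "F \<in> borel_measurable borel" and c: "cmod c = 1"
  shows "(\<integral>\<^sup>+ x. F (c * x) \<partial>lborel) = (\<integral>\<^sup>+ x. F x \<partial>lborel)"
proof -
  define k where "k = (\<lambda>x. ennreal (exp (- cmod x)))"
  have [measurable]: "k \<in> borel_measurable borel" unfolding k_def by measurable
  define B where "B = (\<integral>\<^sup>+ x. k x \<partial>lborel)"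
  \<comment> \<open>A factor can be cancelled in \<open>ennreal\<close> only when it is neither 0
    nor infinite.\<close>
  have B: "0 < B" "B < \<infinity>"
    unfolding B_def k_def
    by (intro nn_integral_lborel_pos, simp, simp, rule nn_integral_exp_norm_finite)
  have c0: "c \<noteq> 0" using c by auto
  have "(\<integral>\<^sup>+ x. F (c * x) \<partial>lborel) * B = (\<integral>\<^sup>+ y. (\<integral>\<^sup>+ x. F (c * x) \<partial>lborel) * k y \<partial>lborel)"
    unfolding B_def by (simp add: nn_integral_cmult)
  also have "\<dots> = (\<integral>\<^sup>+ y. (\<integral>\<^sup>+ x. F (c * x + y) * k y \<partial>lborel) \<partial>lborel)"
  proof (intro nn_integral_cong)
    fix y
    have "(\<integral>\<^sup>+ x. F (c * x) \<partial>lborel) = (\<integral>\<^sup>+ x. F (c * (y / c + x)) \<partial>lborel)"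
      by (rule nn_integral_lborel_translate[symmetric, where F="\<lambda>x. F (c * x)"]) simp
    also have "\<dots> = (\<integral>\<^sup>+ x. F (c * x + y) \<partial>lborel)"
      using c0 by (simp add: distrib_left add.commute)
    finally show "(\<integral>\<^sup>+ x. F (c * x) \<partial>lborel) * k y = (\<integral>\<^sup>+ x. F (c * x + y) * k y \<partial>lborel)"
      by (simp add: nn_integral_multc)
  qed
  also have "\<dots> = (\<integral>\<^sup>+ x. (\<integral>\<^sup>+ y. F (c * x + y) * k y \<partial>lborel) \<partial>lborel)"
    by (rule lborel_pair.Fubini') measurable
  also have "\<dots> = (\<integral>\<^sup>+ x. (\<integral>\<^sup>+ y. F y * k (- c * x + y) \<partial>lborel) \<partial>lborel)"
  proof (rule nn_integral_cong)
    fix x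
    show "(\<integral>\<^sup>+ y. F (c * x + y) * k y \<partial>lborel) = (\<integral>\<^sup>+ y. F y * k (- c * x + y) \<partial>lborel)"
      using nn_integral_lborel_translate[where F="\<lambda>y. F y * k (- c * x + y)" and a="c * x"] by simp
  qed
  also have "\<dots> = (\<integral>\<^sup>+ y. (\<integral>\<^sup>+ x. F y * k (- c * x + y) \<partial>lborel) \<partial>lborel)"
    by (rule lborel_pair.Fubini'[symmetric]) measurable
  also have "\<dots> = (\<integral>\<^sup>+ y. F y * B \<partial>lborel)"
  proof (intro nn_integral_cong)
    fix y
    have "k (- c * x + y) = k (- y / c + x)" for x
    proof -
      have "- c * x + y = (- c) * (- y / c + x)" using c0 by (simp add: field_simps)
      then have "cmod (- c * x + y) = cmod (- y / c + x)" by (metis c norm_mult norm_minus_cancel mult_1)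
      then show ?thesis by (simp add: k_def)
    qed
    then have "(\<integral>\<^sup>+ x. F y * k (- c * x + y) \<partial>lborel) = F y * (\<integral>\<^sup>+ x. k (- y / c + x) \<partial>lborel)"
      by (simp add: nn_integral_cmult)
    then show "(\<integral>\<^sup>+ x. F y * k (- c * x + y) \<partial>lborel) = F y * B"
      by (subst (asm) nn_integral_lborel_translate) (auto simp: B_def)
  qed
  also have "\<dots> = (\<integral>\<^sup>+ x. F x \<partial>lborel) * B"
    by (simp add: nn_integral_multc)
  finally show ?thesis using B
    by (metis ennreal_mult_cancel_left infinity_ennreal_def less_irrefl mult.commute)
qed

section \<open>Mean value inequalities for entire functions\<close>

text \<open>Cauchy's formula for \<open>f (u * w)\<close> as a function of \<open>u\<close> on the
  unit circle. Moving the radius into the function treats all \<open>w\<close>, including 0, alike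
  and leaves a parameter interval independent of \<open>w\<close>, ready for Fubini.\<close>

lemma cmod_le_circle_mean:
  assumes "f holomorphic_on UNIV"
  shows "ennreal (cmod (f 0))
       \<le> (\<integral>\<^sup>+ t. ennreal (cmod (f (exp (2 * of_real pi * \<i> * of_real t) * w))) * indicator {0..1} t \<partial>lborel)"
proof -
  define e where "e t = exp (2 * of_real pi * \<i> * of_real t)" for t :: real
  define h where "h t = f (e t * w)" for t
  have conte: "continuous_on UNIV e" unfolding e_def by (intro continuous_intros)
  have conth: "continuous_on S h" for S
    unfolding h_def using conte
    by (intro continuous_on_compose2[OF holomorphic_on_imp_continuous_on[OF assms]] continuous_intros
        continuous_on_subset[OF conte]) auto
  have hol: "(\<lambda>u. f (u * w)) holomorphic_on S" for S
    using holomorphic_on_compose_gen[of "\<lambda>u. u * w" S f UNIV, OF _ assms]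
    by (simp add: o_def holomorphic_intros)
  have "((\<lambda>u. f (u * w) / (u - 0)) has_contour_integral (2 * of_real pi * \<i> * f (0 * w))) (circlepath 0 1)"
    by (rule Cauchy_integral_circlepath[where f="\<lambda>u. f (u * w)"])
       (auto intro: hol holomorphic_on_imp_continuous_on)
  \<comment> \<open>The derivative of the circle is \<open>2 * pi * \<i>\<close> times the point
    itself, which cancels the denominator of the Cauchy kernel.\<close>
  then have "((\<lambda>t. (2 * of_real pi * \<i>) * h t) has_integral (2 * of_real pi * \<i> * f 0)) {0..1}"
    unfolding has_contour_integral vector_derivative_circlepath
    by (simp add: circlepath h_def e_def mult_ac)
  then have "((\<lambda>t. inverse (2 * of_real pi * \<i>) * ((2 * of_real pi * \<i>) * h t)) has_integral
      inverse (2 * of_real pi * \<i>) * (2 * of_real pi * \<i> * f 0)) {0..1}"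
    by (rule has_integral_mult_right)
  then have "(h has_integral f 0) {0..1}"
    by (simp add: field_simps)
  then have "f 0 = integral {0..1} h" by (simp add: integral_unique)
  moreover have "cmod (integral {0..1} h) \<le> integral {0..1} (\<lambda>t. cmod (h t))"
    by (intro integral_norm_bound_integral integrable_continuous_real conth continuous_intros) auto
  ultimately have "ennreal (cmod (f 0)) \<le> ennreal (integral {0..1} (\<lambda>t. cmod (h t)))"
    by (simp add: ennreal_leI)
  also have "\<dots> = (\<integral>\<^sup>+ t. ennreal (cmod (h t)) * indicator {0..1} t \<partial>lborel)"
    by (rule nn_integral_has_integral_lebesgue'[symmetric])
       (auto intro!: integrable_integral integrable_continuous_real conth continuous_intros)
  finally show ?thesis by (simp add: h_def e_def)
qed

text \<open>The circle means are integrated against the weight in \<open>w\<close>. After exchanging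
  the integrals, each rotation by \<open>e t\<close> preserves both the measure and the radial
  weight, so the integral in \<open>t\<close> is over a constant. This replaces polar
  coordinates.\<close>

lemma cmod_mult_integral_le_radial:
  fixes k :: "real \<Rightarrow> real"
  assumes f: "f holomorphic_on UNIV" and [measurable]: "k \<in> borel_measurable borel"
  shows "ennreal (cmod (f 0)) * (\<integral>\<^sup>+ w. ennreal (k (cmod w)) \<partial>lborel)
       \<le> (\<integral>\<^sup>+ w. ennreal (cmod (f w)) * ennreal (k (cmod w)) \<partial>lborel)"
proof -
  define e where "e t = exp (2 * of_real pi * \<i> * of_real t)" for t :: real
  have [measurable]: "e \<in> borel_measurable borel"
    unfolding e_def by (intro borel_measurable_continuous_onI continuous_intros)
  have [measurable]: "f \<in> borel_measurable borel"
    by (intro borel_measurable_continuous_onI holomorphic_on_imp_continuous_on f)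
  have e1: "cmod (e t) = 1" for t by (simp add: e_def)
  define I where "I = (\<integral>\<^sup>+ w. ennreal (cmod (f w)) * ennreal (k (cmod w)) \<partial>lborel)"
  have "ennreal (cmod (f 0)) * (\<integral>\<^sup>+ w. ennreal (k (cmod w)) \<partial>lborel)
      = (\<integral>\<^sup>+ w. ennreal (cmod (f 0)) * ennreal (k (cmod w)) \<partial>lborel)"
    by (simp add: nn_integral_cmult)
  also have "\<dots> \<le> (\<integral>\<^sup>+ w. (\<integral>\<^sup>+ t. ennreal (cmod (f (e t * w))) * indicator {0..1} t \<partial>lborel) * ennreal (k (cmod w)) \<partial>lborel)"
    unfolding e_def by (intro nn_integral_mono mult_right_mono cmod_le_circle_mean f) auto
  also have "\<dots> = (\<integral>\<^sup>+ w. (\<integral>\<^sup>+ t. ennreal (cmod (f (e t * w))) * indicator {0..1} t * ennreal (k (cmod w)) \<partial>lborel) \<partial>lborel)"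
    by (simp add: nn_integral_multc)
  also have "\<dots> = (\<integral>\<^sup>+ t. (\<integral>\<^sup>+ w. ennreal (cmod (f (e t * w))) * indicator {0..1} t * ennreal (k (cmod w)) \<partial>lborel) \<partial>lborel)"
    by (rule lborel_pair.Fubini') measurable
  also have "\<dots> = (\<integral>\<^sup>+ t. I * indicator {0..1::real} t \<partial>lborel)"
  proof (rule nn_integral_cong)
    fix t :: real
    have "I = (\<integral>\<^sup>+ w. ennreal (cmod (f (e t * w))) * ennreal (k (cmod (e t * w))) \<partial>lborel)"
      unfolding I_def
      by (rule nn_integral_lborel_rotate[symmetric, where F="\<lambda>w. ennreal (cmod (f w)) * ennreal (k (cmod w))"])
         (auto simp: e1)
    then have "I * indicator {0..1} t = (\<integral>\<^sup>+ w. ennreal (cmod (f (e t * w))) * ennreal (k (cmod (e t * w))) * indicator {0..1} t \<partial>lborel)"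
      by (simp add: nn_integral_multc)
    then show "(\<integral>\<^sup>+ w. ennreal (cmod (f (e t * w))) * indicator {0..1} t * ennreal (k (cmod w)) \<partial>lborel) = I * indicator {0..1} t"
      by (simp add: norm_mult e1 mult_ac)
  qed
  also have "\<dots> = I" by (simp add: nn_integral_cmult)
  finally show ?thesis by (simp add: I_def)
qed

section \<open>The weighted modulus and its convolution with the exponential kernel\<close>

text \<open>For finite \<open>p\<close>, \<open>fock_norm p f\<close> is a constant multiple of the
  L^p norm of this function, and for infinite \<open>p\<close> it is its supremum, so one weight
  serves all exponents.\<close>

definition gauss_mod :: "(complex \<Rightarrow> complex) \<Rightarrow> complex \<Rightarrow> real" where
  "gauss_mod f z = cmod (f z) * exp (- (cmod z)\<^sup>2 / 2)"

lemma gauss_mod_nonneg [simp]: "gauss_mod f z \<ge> 0"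
  by (simp add: gauss_mod_def)

lemma borel_measurable_entire:
  "f holomorphic_on UNIV \<Longrightarrow> f \<in> borel_measurable borel"
  by (intro borel_measurable_continuous_onI holomorphic_on_imp_continuous_on)

lemma borel_measurable_gauss_mod [measurable]:
  "f \<in> borel_measurable borel \<Longrightarrow> gauss_mod f \<in> borel_measurable borel"
proof -
  assume [measurable]: "f \<in> borel_measurable borel"
  have [measurable]: "(\<lambda>z. exp (- (cmod z)\<^sup>2 / 2)) \<in> borel_measurable borel"
    by (intro borel_measurable_continuous_onI continuous_intros) auto
  show ?thesis unfolding gauss_mod_def by measurable
qed

text \<open>Values in \<open>ennreal\<close> allow Fubini and comparison before anything is known
  about integrability of \<open>u\<close>.\<close>

definition exp_conv :: "(complex \<Rightarrow> real) \<Rightarrow> complex \<Rightarrow> ennreal" where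
  "exp_conv u z = (\<integral>\<^sup>+ w. ennreal (u w) * ennreal (exp (- cmod (z - w))) \<partial>lborel)"

lemma borel_measurable_exp_conv [measurable]:
  assumes [measurable]: "u \<in> borel_measurable borel"
  shows "exp_conv u \<in> borel_measurable borel"
  unfolding exp_conv_def by measurable

text \<open>The triangle inequality inside the kernel. It is the Lipschitz bound for the logarithm
  in multiplicative form, meaningful also for the values 0 and infinity.\<close>

lemma exp_conv_le_shift:
  assumes [measurable]: "u \<in> borel_measurable borel"
  shows "exp_conv u w \<le> ennreal (exp (cmod (z - w))) * exp_conv u z"
proof -
  have "exp_conv u w \<le> (\<integral>\<^sup>+ v. ennreal (exp (cmod (z - w))) * (ennreal (u v) * ennreal (exp (- cmod (z - v)))) \<partial>lborel)"
    unfolding exp_conv_def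
  proof (rule nn_integral_mono)
    fix v
    have "cmod (z - v) \<le> cmod (z - w) + cmod (w - v)"
      using norm_triangle_ineq[of "z - w" "w - v"] by simp
    then have "exp (- cmod (w - v)) \<le> exp (cmod (z - w)) * exp (- cmod (z - v))"
      by (simp flip: exp_add)
    then have "ennreal (exp (- cmod (w - v))) \<le> ennreal (exp (cmod (z - w))) * ennreal (exp (- cmod (z - v)))"
      by (simp add: ennreal_leI flip: ennreal_mult)
    then show "ennreal (u v) * ennreal (exp (- cmod (w - v)))
        \<le> ennreal (exp (cmod (z - w))) * (ennreal (u v) * ennreal (exp (- cmod (z - v))))"
      by (metis mult.left_commute mult_left_mono zero_le)
  qed
  also have "\<dots> = ennreal (exp (cmod (z - w))) * exp_conv u z"
    by (simp add: nn_integral_cmult exp_conv_def)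
  finally show ?thesis .
qed

lemma exp_conv_le_nn_integral:
  assumes [measurable]: "u \<in> borel_measurable borel"
  shows "exp_conv u z \<le> (\<integral>\<^sup>+ w. ennreal (u w) \<partial>lborel)"
  unfolding exp_conv_def
proof (rule nn_integral_mono)
  fix w
  have "ennreal (exp (- cmod (z - w))) \<le> 1" by simp
  then show "ennreal (u w) * ennreal (exp (- cmod (z - w))) \<le> ennreal (u w)"
    by (metis mult.right_neutral mult_left_mono zero_le)
qed

abbreviation exp_mass :: ennreal where
  "exp_mass \<equiv> (\<integral>\<^sup>+ w. ennreal (exp (- cmod w)) \<partial>lborel)"

lemma nn_integral_exp_shift:
  "(\<integral>\<^sup>+ w. ennreal (exp (- cmod (z - w))) \<partial>lborel) = exp_mass"
  using nn_integral_lborel_translate[of "\<lambda>w. ennreal (exp (- cmod w))" "- z"]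
  by (simp add: norm_minus_commute)

text \<open>Tonelli. Together with \<open>exp_conv_le_nn_integral\<close> it bounds the convolution
  of an integrable function both in L^1 and uniformly, and all exponents between follow.\<close>

lemma nn_integral_exp_conv:
  assumes [measurable]: "u \<in> borel_measurable borel"
  shows "(\<integral>\<^sup>+ z. exp_conv u z \<partial>lborel) = (\<integral>\<^sup>+ w. ennreal (u w) \<partial>lborel) * exp_mass"
proof -
  have "(\<integral>\<^sup>+ z. exp_conv u z \<partial>lborel)
     = (\<integral>\<^sup>+ w. (\<integral>\<^sup>+ z. ennreal (u w) * ennreal (exp (- cmod (z - w))) \<partial>lborel) \<partial>lborel)"
    unfolding exp_conv_def by (rule lborel_pair.Fubini') measurable
  also have "\<dots> = (\<integral>\<^sup>+ w. ennreal (u w) * exp_mass \<partial>lborel)"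
    by (intro nn_integral_cong)
       (simp add: nn_integral_cmult nn_integral_exp_shift norm_minus_commute)
  also have "\<dots> = (\<integral>\<^sup>+ w. ennreal (u w) \<partial>lborel) * exp_mass"
    by (simp add: nn_integral_multc)
  finally show ?thesis .
qed

text \<open>Multiplying \<open>f (z + w)\<close> by the entire function \<open>exp (- cnj z * w)\<close> turns the Gaussian weight
  centred at \<open>0\<close> into the one centred at \<open>z\<close>.\<close>

lemma gauss_mod_le_exp_conv:
  assumes f: "f holomorphic_on UNIV"
  shows "ennreal (gauss_mod f z) * (\<integral>\<^sup>+ w. ennreal (exp (- (cmod w)\<^sup>2 / 2 - cmod w)) \<partial>(lborel :: complex measure))
     \<le> exp_conv (gauss_mod f) z"
proof -
  note [measurable] = borel_measurable_entire[OF f]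
  define F where "F w = f (z + w) * exp (- cnj z * w)" for w
  have "(\<lambda>w. f (z + w)) holomorphic_on UNIV"
    using holomorphic_on_compose_gen[of "\<lambda>w. z + w" UNIV f UNIV, OF _ f]
    by (simp add: o_def holomorphic_intros)
  then have F: "F holomorphic_on UNIV"
    unfolding F_def by (intro holomorphic_intros)
  define e where "e = exp (- (cmod z)\<^sup>2 / 2)"
  have e: "e > 0" by (simp add: e_def)
  define K where "K = (\<integral>\<^sup>+ w. ennreal (exp (- (cmod w)\<^sup>2 / 2 - cmod w)) \<partial>(lborel :: complex measure))"
  have eq: "e * (cmod (F w) * exp (- (cmod w)\<^sup>2 / 2 - cmod w)) = gauss_mod f (z + w) * exp (- cmod w)" for w
  proof -
    have "(cmod (z + w))\<^sup>2 = (cmod z)\<^sup>2 + (cmod w)\<^sup>2 + 2 * Re (cnj z * w)"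
      unfolding cmod_power2 by (simp add: power2_eq_square algebra_simps)
    then have "- (cmod (z + w))\<^sup>2 / 2 = - (cmod z)\<^sup>2 / 2 - Re (cnj z * w) - (cmod w)\<^sup>2 / 2"
      by (simp add: field_simps)
    then have "e * (exp (- Re (cnj z * w)) * exp (- (cmod w)\<^sup>2 / 2 - cmod w))
        = exp (- (cmod (z + w))\<^sup>2 / 2) * exp (- cmod w)"
      unfolding e_def exp_add[symmetric] by simp
    moreover have "cmod (F w) = cmod (f (z + w)) * exp (- Re (cnj z * w))"
      by (simp add: F_def norm_mult)
    ultimately show ?thesis by (simp add: gauss_mod_def mult_ac)
  qed
  have K_meas: "(\<lambda>w. ennreal (exp (- (cmod w)\<^sup>2 / 2 - cmod w))) \<in> borel_measurable lborel"
    unfolding measurable_lborel1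
    by (intro measurable_compose[OF _ measurable_ennreal] borel_measurable_continuous_onI continuous_intros) auto
  have F_meas: "(\<lambda>w. ennreal (cmod (F w))) \<in> borel_measurable lborel"
    using borel_measurable_entire[OF F] by measurable
  \<comment> \<open>Since \<open>F 0 = f z\<close>, the radial inequality for \<open>F\<close> at 0
    is the desired estimate at \<open>z\<close>.\<close>
  have "ennreal (gauss_mod f z) * K = ennreal e * (ennreal (cmod (F 0)) * K)"
    by (simp add: gauss_mod_def F_def e_def ennreal_mult mult_ac)
  also have "\<dots> \<le> ennreal e * (\<integral>\<^sup>+ w. ennreal (cmod (F w)) * ennreal (exp (- (cmod w)\<^sup>2 / 2 - cmod w)) \<partial>lborel)"
    unfolding K_def
    by (intro mult_left_mono cmod_mult_integral_le_radial[where k="\<lambda>x. exp (- x\<^sup>2 / 2 - x)"] F) auto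
  also have "\<dots> = (\<integral>\<^sup>+ w. ennreal e * (ennreal (cmod (F w)) * ennreal (exp (- (cmod w)\<^sup>2 / 2 - cmod w))) \<partial>lborel)"
    by (intro nn_integral_cmult[symmetric] borel_measurable_times_ennreal F_meas K_meas)
  also have "\<dots> = (\<integral>\<^sup>+ w. ennreal (gauss_mod f (z + w)) * ennreal (exp (- cmod (z - (z + w)))) \<partial>lborel)"
    using eq e by (intro nn_integral_cong) (simp flip: ennreal_mult)
  also have "\<dots> = exp_conv (gauss_mod f) z"
    unfolding exp_conv_def
    by (rule nn_integral_lborel_translate[where F="\<lambda>w. ennreal (gauss_mod f w) * ennreal (exp (- cmod (z - w)))"]) measurable
  finally show ?thesis by (simp add: K_def)
qed

section \<open>The integration operator: pointwise estimate\<close>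

lemma volterra_id_integral:
  "volterra (\<lambda>z. z) f z = integral {0..1} (\<lambda>t. f (of_real t * z) * z)"
  by (simp add: volterra_def contour_integral_integral linepath_def scaleR_conv_of_real)

text \<open>On the convex domain \<open>UNIV\<close> the function has a global primitive, and
  integrating along the segment gives its increment.\<close>

lemma volterra_id_holomorphic:
  assumes "f holomorphic_on UNIV"
  shows "volterra (\<lambda>z. z) f holomorphic_on UNIV"
proof -
  obtain F where F: "\<And>x. (F has_field_derivative f x) (at x)"
    using holomorphic_convex_primitive'[of UNIV f] assms by auto
  have "volterra (\<lambda>z. z) f z = F z - F 0" for z
    using contour_integral_primitive[where S=UNIV and f=F and f'=f and g="linepath 0 z", OF F] F
    by (auto simp: volterra_def intro!: contour_integral_unique)
  moreover have "F holomorphic_on UNIV"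
    using F by (auto simp: holomorphic_on_def field_differentiable_def intro: has_field_derivative_at_within)
  ultimately show ?thesis
    by (metis (no_types, lifting) ext holomorphic_on_const holomorphic_on_diff)
qed

lemma volterra_id_pointwise:
  obtains C where "C > 0"
    "\<And>f z. f holomorphic_on UNIV \<Longrightarrow> ennreal (gauss_mod (volterra (\<lambda>z. z) f) z) \<le> ennreal C * exp_conv (gauss_mod f) z"
proof -
  define A where "A = (\<integral>\<^sup>+ w. ennreal (exp (- (cmod w)\<^sup>2 / 2 - cmod w)) \<partial>(lborel :: complex measure))"
  have "A \<le> exp_mass" unfolding A_def by (intro nn_integral_mono ennreal_leI) auto
  then have "A < \<infinity>" using nn_integral_exp_norm_finite by (rule le_less_trans)
  moreover have "A > 0" unfolding A_def by (intro nn_integral_lborel_pos) auto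
  ultimately obtain a where a: "A = ennreal a" "a > 0"
    by (cases A) auto
  show ?thesis
  proof (rule that[of "exp 2 / a"])
    show "exp 2 / a > 0" using a by simp
    fix f z assume f: "f holomorphic_on UNIV"
    note [measurable] = borel_measurable_entire[OF f]
    show "ennreal (gauss_mod (volterra (\<lambda>z. z) f) z) \<le> ennreal (exp 2 / a) * exp_conv (gauss_mod f) z"
    proof (cases "exp_conv (gauss_mod f) z")
      \<comment> \<open>The constant \<open>exp 2 / a\<close> is positive, so the right-hand side is
        infinite.\<close>
      case top
      then show ?thesis using a by (simp add: ennreal_mult_top)
    next
      case (real h)
      define R where "R = cmod z"
      \<comment> \<open>The local estimate at \<open>w\<close> is transported to the endpoint
        \<open>z\<close>, so that the single number \<open>h\<close> controls \<open>f\<close> along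
        the whole segment.\<close>
      have bd: "cmod (f w) \<le> h / a * exp (cmod (z - w) + (cmod w)\<^sup>2 / 2)" for w
      proof -
        have "ennreal (gauss_mod f w) * A \<le> exp_conv (gauss_mod f) w"
          unfolding A_def by (rule gauss_mod_le_exp_conv[OF f])
        also have "\<dots> \<le> ennreal (exp (cmod (z - w))) * ennreal h"
          unfolding real(2)[symmetric] by (rule exp_conv_le_shift) measurable
        finally have "gauss_mod f w * a \<le> exp (cmod (z - w)) * h"
          using real a by (simp flip: ennreal_mult)
        then have "gauss_mod f w * exp ((cmod w)\<^sup>2 / 2) \<le> h / a * exp (cmod (z - w)) * exp ((cmod w)\<^sup>2 / 2)"
          using a by (intro mult_right_mono) (auto simp: field_simps)
        moreover have "gauss_mod f w * exp ((cmod w)\<^sup>2 / 2) = cmod (f w)"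
          by (simp add: gauss_mod_def flip: exp_add)
        ultimately show ?thesis by (simp add: exp_add)
      qed
      \<comment> \<open>The length \<open>R\<close> of the segment times the decaying exponential
        integrates over \<open>t\<close> to \<open>1 - exp (- R)\<close>, which is at most 1
        uniformly in \<open>z\<close>.\<close>
      have bd': "cmod (f (of_real t * z) * z) \<le> h / a * exp (R\<^sup>2 / 2 + 2) * (R * exp (- (1 - t) * R))" if t: "t \<in> {0..1}" for t
      proof -
        have R: "R \<ge> 0" by (simp add: R_def)
        have "z - of_real t * z = of_real (1 - t) * z" by (simp add: algebra_simps)
        then have "cmod (z - of_real t * z) = (1 - t) * R"
          using t by (simp add: norm_mult R_def del: of_real_diff)
        moreover have "cmod (of_real t * z) = t * R" using t by (simp add: norm_mult R_def)
        ultimately have "cmod (f (of_real t * z)) \<le> h / a * exp ((1 - t) * R + (t * R)\<^sup>2 / 2)"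
          using bd[of "of_real t * z"] by simp
        also have "\<dots> \<le> h / a * exp ((R\<^sup>2 / 2 + 2) + (- (1 - t) * R))"
        proof -
          define x where "x = (1 - t) * R"
          have x: "x \<ge> 0" "x \<le> R" using t R by (auto simp: x_def mult_left_le_one_le)
          have tR: "t * R = R - x" by (simp add: x_def algebra_simps)
          \<comment> \<open>Here \<open>x\<close> is the distance from \<open>z\<close> to the point
            w of the segment, and |z|^2 - |w|^2 = 2 x R - x^2 is at least x^2. Half of that absorbs
            2 x up to the constant 2, because 2 x is at most x^2 / 2 + 2.\<close>
          have "x * x \<le> x * R" using x by (intro mult_left_mono)
          moreover have "(x - 2)\<^sup>2 \<ge> 0" by simp
          ultimately have "x + (R - x)\<^sup>2 / 2 \<le> R\<^sup>2 / 2 + 2 - x"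
            by (simp add: power2_eq_square field_simps)
          then have "(1 - t) * R + (t * R)\<^sup>2 / 2 \<le> (R\<^sup>2 / 2 + 2) + (- (1 - t) * R)"
            unfolding tR by (simp add: x_def algebra_simps)
          then show ?thesis using real a by (intro mult_left_mono) auto
        qed
        finally have "cmod (f (of_real t * z)) * R \<le> h / a * exp ((R\<^sup>2 / 2 + 2) + (- (1 - t) * R)) * R"
          using R by (intro mult_right_mono)
        then show ?thesis by (simp add: norm_mult R_def exp_add mult_ac)
      qed
      have I: "((\<lambda>t. R * exp (- (1 - t) * R)) has_integral (exp (- (1 - 1) * R) - exp (- (1 - 0) * R))) {0..1}"
        by (rule fundamental_theorem_of_calculus)
           (auto intro!: derivative_eq_intros simp flip: has_real_derivative_iff_has_vector_derivative)
      have contf: "continuous_on S f" for S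
        using f holomorphic_on_imp_continuous_on holomorphic_on_subset by blast
      have "cmod (volterra (\<lambda>z. z) f z) \<le> integral {0..1} (\<lambda>t. h / a * exp (R\<^sup>2 / 2 + 2) * (R * exp (- (1 - t) * R)))"
        unfolding volterra_id_integral
        by (intro integral_norm_bound_integral integrable_continuous_real bd' continuous_intros
            continuous_on_compose2[OF contf[of UNIV]]) auto
      also have "\<dots> = h / a * exp (R\<^sup>2 / 2 + 2) * (1 - exp (- R))"
        using integral_unique[OF has_integral_mult_right[OF I, of "h / a * exp (R\<^sup>2 / 2 + 2)"]] by simp
      also have "\<dots> \<le> h / a * exp (R\<^sup>2 / 2 + 2) * 1"
        using real a by (intro mult_left_mono) auto
      finally have "gauss_mod (volterra (\<lambda>z. z) f) z \<le> h / a * exp (R\<^sup>2 / 2 + 2) * exp (- (cmod z)\<^sup>2 / 2)"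
        unfolding gauss_mod_def by (intro mult_right_mono) auto
      also have "\<dots> = exp 2 / a * h"
        by (simp add: R_def flip: exp_add)
      finally have "gauss_mod (volterra (\<lambda>z. z) f) z \<le> exp 2 / a * h" .
      then have "ennreal (gauss_mod (volterra (\<lambda>z. z) f) z) \<le> ennreal (exp 2 / a * h)" by (rule ennreal_leI)
      also have "\<dots> = ennreal (exp 2 / a) * ennreal h" using a real by (intro ennreal_mult) auto
      finally show ?thesis using real by simp
    qed
  qed
qed

section \<open>Bounds for the convolution from L^p to L^q\<close>

text \<open>Either \<open>a\<close> is at most \<open>t\<close>, or (a / t)^(p - 1) is at least 1
  and the second term alone suffices. The free parameter \<open>t\<close> is chosen later to balance
  the two terms.\<close>

lemma le_add_powr:
  fixes a t p :: real
  assumes "a \<ge> 0" "t > 0" "p \<ge> 1"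
  shows "a \<le> t + a powr p * t powr (1 - p)"
proof (cases "a \<le> t")
  case True
  then show ?thesis using assms by (simp add: add_increasing2)
next
  case False
  then have "a powr (p - 1) \<ge> t powr (p - 1)" using assms by (intro powr_mono2) auto
  then have "a powr p * t powr (1 - p) \<ge> a * (t powr (p - 1) * t powr (1 - p))"
    using assms False by (auto simp: powr_diff field_simps intro!: mult_left_mono)
  also have "t powr (p - 1) * t powr (1 - p) = 1"
    using assms by (simp flip: powr_add)
  finally show ?thesis using assms by simp
qed

text \<open>Hoelder's inequality up to a constant: take \<open>t = x powr (1 / p)\<close> in \<open>le_add_powr\<close>.\<close>

lemma exp_conv_le_powr:
  assumes [measurable]: "u \<in> borel_measurable borel" and u: "\<And>w. u w \<ge> 0" and p: "p \<ge> 1"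
    and X: "exp_conv (\<lambda>w. u w powr p) z = ennreal x" "x \<ge> 0"
  shows "exp_conv u z \<le> ennreal ((enn2real exp_mass + 1) * x powr (1 / p))"
proof -
  define b where "b = enn2real exp_mass"
  have b: "exp_mass = ennreal b" "b \<ge> 0"
    using nn_integral_exp_norm_finite by (auto simp: b_def)
  have *: "exp_conv u z \<le> ennreal (t * b + t powr (1 - p) * x)" if t: "t > 0" for t
  proof -
    have "exp_conv u z \<le> (\<integral>\<^sup>+ w. ennreal t * ennreal (exp (- cmod (z - w)))
        + ennreal (t powr (1 - p)) * (ennreal (u w powr p) * ennreal (exp (- cmod (z - w)))) \<partial>lborel)"
      unfolding exp_conv_def
    proof (rule nn_integral_mono)
      fix w
      have "u w * exp (- cmod (z - w)) \<le> (t + u w powr p * t powr (1 - p)) * exp (- cmod (z - w))"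
        by (intro mult_right_mono le_add_powr u t p) auto
      also have "\<dots> = t * exp (- cmod (z - w)) + t powr (1 - p) * (u w powr p * exp (- cmod (z - w)))"
        by (simp add: algebra_simps)
      finally show "ennreal (u w) * ennreal (exp (- cmod (z - w))) \<le> ennreal t * ennreal (exp (- cmod (z - w)))
        + ennreal (t powr (1 - p)) * (ennreal (u w powr p) * ennreal (exp (- cmod (z - w))))"
        using t u by (simp flip: ennreal_mult ennreal_plus)
    qed
    also have "\<dots> = ennreal t * exp_mass + ennreal (t powr (1 - p)) * exp_conv (\<lambda>w. u w powr p) z"
      unfolding exp_conv_def
      by (simp add: nn_integral_add nn_integral_cmult nn_integral_exp_shift)
    also have "\<dots> = ennreal (t * b + t powr (1 - p) * x)"
      using t b X by (simp add: ennreal_mult ennreal_plus)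
    finally show ?thesis .
  qed
  show ?thesis
  proof (cases "x = 0")
    \<comment> \<open>The balancing choice of \<open>t\<close> would be 0 here, so \<open>t\<close>
      is made arbitrarily small instead.\<close>
    case True
    have "exp_conv u z \<le> 0"
    proof (rule ennreal_le_epsilon)
      fix e :: real assume e: "e > 0"
      have "exp_conv u z \<le> ennreal (e / (b + 1) * b)"
        using *[of "e / (b + 1)"] e b True by simp
      also have "e / (b + 1) * b \<le> e" using e b by (simp add: field_simps)
      finally show "exp_conv u z \<le> 0 + ennreal e" by (simp add: ennreal_leI)
    qed
    then show ?thesis by simp
  next
    case False
    then have x: "x > 0" using X by simp
    \<comment> \<open>With \<open>t = x powr (1 / p)\<close> the second term also becomes
      \<open>x powr (1 / p)\<close>, whence the summand 1 beside the mass.\<close>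
    have "(x powr (1 / p)) powr (1 - p) * x = x powr (1 / p * (1 - p) + 1)"
      using x by (simp add: powr_powr powr_add)
    also have "1 / p * (1 - p) + 1 = 1 / p" using p by (simp add: field_simps)
    finally show ?thesis
      using *[of "x powr (1 / p)"] x by (simp add: b_def algebra_simps)
  qed
qed

text \<open>The convolution \<open>X\<close> of \<open>u powr p\<close> is at most \<open>M\<close>
  everywhere and has integral at most \<open>M\<close> times the mass. As \<open>exp_conv u\<close>
  is at most a constant times \<open>X powr (1 / p)\<close>, its q-th power is at most a constant
  times \<open>X powr (q / p)\<close>; for q >= p all but one factor of \<open>X\<close> is bounded
  by \<open>M\<close>, and the remaining one is integrated.\<close>

lemma exp_conv_powr_bounds:
  assumes [measurable]: "u \<in> borel_measurable borel" and u: "\<And>w. u w \<ge> 0" and p: "p \<ge> 1"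
    and M: "(\<integral>\<^sup>+ w. ennreal (u w powr p) \<partial>lborel) \<le> ennreal M" "M > 0"
  shows "exp_conv u z \<le> ennreal ((enn2real exp_mass + 1) * M powr (1 / p))"
    and "p \<le> q \<Longrightarrow> (\<integral>\<^sup>+ z. ennreal (enn2real (exp_conv u z) powr q) \<partial>lborel)
      \<le> ennreal (((enn2real exp_mass + 1) powr q * M powr (q / p - 1)) * (M * enn2real exp_mass))"
proof -
  define b where "b = enn2real exp_mass"
  have b: "exp_mass = ennreal b" "b \<ge> 0"
    using nn_integral_exp_norm_finite by (auto simp: b_def)
  define X where "X z = enn2real (exp_conv (\<lambda>w. u w powr p) z)" for z
  have le: "exp_conv (\<lambda>w. u w powr p) z \<le> ennreal M" for z
    by (rule order_trans[OF exp_conv_le_nn_integral M(1)]) measurable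
  have eX: "exp_conv (\<lambda>w. u w powr p) z = ennreal (X z)" for z
    using le[of z] by (cases "exp_conv (\<lambda>w. u w powr p) z") (auto simp: X_def top_unique)
  have X: "0 \<le> X z" "X z \<le> M" for z
    using le[of z] M(2) unfolding eX by (auto simp: X_def)
  have conv: "exp_conv u z \<le> ennreal ((b + 1) * X z powr (1 / p))" for z
    unfolding b_def by (rule exp_conv_le_powr[OF _ u p eX X(1)]) measurable
  have conv': "enn2real (exp_conv u z) \<le> (b + 1) * X z powr (1 / p)" for z
    using conv[of z] b by (intro enn2real_leI) auto
  show "exp_conv u z \<le> ennreal ((enn2real exp_mass + 1) * M powr (1 / p))"
    unfolding b_def[symmetric] using X[of z] p b
    by (intro order_trans[OF conv] ennreal_leI mult_left_mono powr_mono2) auto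
  assume pq: "p \<le> q"
  have pw: "enn2real (exp_conv u z) powr q \<le> (b + 1) powr q * M powr (q / p - 1) * X z" for z
  proof -
    have "enn2real (exp_conv u z) powr q \<le> ((b + 1) * X z powr (1 / p)) powr q"
      using conv' p pq by (intro powr_mono2) auto
    also have "\<dots> = (b + 1) powr q * X z powr (q / p)"
      using b X[of z] by (simp add: powr_mult powr_powr)
    also have "X z powr (q / p) = X z powr (q / p - 1) * X z"
      using X[of z] by (cases "X z = 0") (auto simp: powr_diff)
    also have "X z powr (q / p - 1) * X z \<le> M powr (q / p - 1) * X z"
      using X[of z] p pq by (intro mult_right_mono powr_mono2) auto
    finally show ?thesis by (simp add: mult.assoc mult_left_mono)
  qed
  have [measurable]: "X \<in> borel_measurable borel" unfolding X_def by measurable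
  have "(\<integral>\<^sup>+ z. ennreal (enn2real (exp_conv u z) powr q) \<partial>lborel)
      \<le> (\<integral>\<^sup>+ z. ennreal ((b + 1) powr q * M powr (q / p - 1)) * exp_conv (\<lambda>w. u w powr p) z \<partial>lborel)"
    unfolding eX using X
    by (intro nn_integral_mono) (auto intro!: ennreal_leI pw simp flip: ennreal_mult)
  also have "\<dots> = ennreal ((b + 1) powr q * M powr (q / p - 1)) * ((\<integral>\<^sup>+ w. ennreal (u w powr p) \<partial>lborel) * exp_mass)"
    by (simp add: nn_integral_cmult nn_integral_exp_conv)
  also have "\<dots> \<le> ennreal ((b + 1) powr q * M powr (q / p - 1)) * (ennreal M * exp_mass)"
    by (intro mult_left_mono mult_right_mono M) auto
  also have "\<dots> = ennreal (((b + 1) powr q * M powr (q / p - 1)) * (M * b))"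
    using b M(2) by (simp add: ennreal_mult)
  finally show "(\<integral>\<^sup>+ z. ennreal (enn2real (exp_conv u z) powr q) \<partial>lborel)
      \<le> ennreal (((enn2real exp_mass + 1) powr q * M powr (q / p - 1)) * (M * enn2real exp_mass))"
    by (simp add: b_def)
qed

lemma exp_conv_le_bound:
  assumes u: "\<And>w. u w \<le> M"
  shows "exp_conv u z \<le> ennreal M * exp_mass"
proof -
  have "exp_conv u z \<le> (\<integral>\<^sup>+ w. ennreal M * ennreal (exp (- cmod (z - w))) \<partial>lborel)"
    unfolding exp_conv_def by (intro nn_integral_mono mult_right_mono ennreal_leI u) auto
  then show ?thesis by (simp add: nn_integral_cmult nn_integral_exp_shift)
qed

section \<open>Fock norms in terms of the weighted modulus, scalar multiples and constants\<close>

lemma fock_norm_PInf_le_iff: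
  assumes "M \<ge> 0"
  shows "fock_norm \<infinity> f \<le> ennreal M \<longleftrightarrow> (\<forall>z. gauss_mod f z \<le> M)"
  using assms by (simp add: fock_norm_def SUP_le_iff gauss_mod_def)

text \<open>Trades the root, the normalising factor and the case distinction in
  \<open>fock_norm\<close> for a plain bound on an integral, the form in which the convolution
  estimates apply.\<close>

lemma fock_norm_real_le_iff:
  assumes p: "p > 0" and M: "M \<ge> 0"
  shows "fock_norm (ereal p) f \<le> ennreal M \<longleftrightarrow>
    (\<integral>\<^sup>+ z. ennreal (gauss_mod f z powr p) \<partial>lborel) \<le> ennreal (2 * pi / p * M powr p)"
proof -
  define J where "J = (\<integral>\<^sup>+ z. ennreal (gauss_mod f z powr p) \<partial>lborel)"
  have "gauss_mod f z powr p = cmod (f z) powr p * exp (- p / 2 * (cmod z)\<^sup>2)" for z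
    by (simp add: gauss_mod_def powr_mult exp_powr_real mult_ac)
  then have norm: "fock_norm (ereal p) f = (let I = ennreal (p / (2 * pi)) * J in
      if I = \<infinity> then \<infinity> else ennreal (enn2real I powr (1 / p)))"
    by (simp add: fock_norm_def J_def)
  show ?thesis
    unfolding J_def[symmetric]
  proof (cases J)
    case top
    then show "(fock_norm (ereal p) f \<le> ennreal M) = (J \<le> ennreal (2 * pi / p * M powr p))"
      using p by (simp add: norm ennreal_mult_top top_unique)
  next
    case (real j)
    have "fock_norm (ereal p) f = ennreal ((p / (2 * pi) * j) powr (1 / p))"
      using p real by (simp add: norm flip: ennreal_mult)
    then have "fock_norm (ereal p) f \<le> ennreal M \<longleftrightarrow> (p / (2 * pi) * j) powr (1 / p) \<le> M"
      using M by simp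
    also have "\<dots> \<longleftrightarrow> p / (2 * pi) * j \<le> M powr p"
    proof
      assume "(p / (2 * pi) * j) powr (1 / p) \<le> M"
      then have "((p / (2 * pi) * j) powr (1 / p)) powr p \<le> M powr p"
        using p by (intro powr_mono2) auto
      then show "p / (2 * pi) * j \<le> M powr p" using p real by (simp add: powr_powr)
    next
      assume "p / (2 * pi) * j \<le> M powr p"
      then have "(p / (2 * pi) * j) powr (1 / p) \<le> (M powr p) powr (1 / p)"
        using p real by (intro powr_mono2) auto
      then show "(p / (2 * pi) * j) powr (1 / p) \<le> M" using p M by (simp add: powr_powr)
    qed
    also have "\<dots> \<longleftrightarrow> j \<le> 2 * pi / p * M powr p" using p by (simp add: field_simps)
    also have "\<dots> \<longleftrightarrow> J \<le> ennreal (2 * pi / p * M powr p)" using real p by simp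
    finally show "(fock_norm (ereal p) f \<le> ennreal M) = (J \<le> ennreal (2 * pi / p * M powr p))" .
  qed
qed

lemma fock_norm_cmult_le:
  assumes p: "p \<ge> 1" and M: "M \<ge> 0" and hol: "f holomorphic_on UNIV"
    and f: "fock_norm p f \<le> ennreal M"
  shows "fock_norm p (\<lambda>z. c * f z) \<le> ennreal (cmod c * M)"
proof -
  note [measurable] = borel_measurable_entire[OF hol]
  have eq: "gauss_mod (\<lambda>z. c * f z) z = cmod c * gauss_mod f z" for z
    by (simp add: gauss_mod_def norm_mult)
  show ?thesis
  proof (cases p)
    case (real s)
    then have s: "s > 0" using p by simp
    have "(\<integral>\<^sup>+ z. ennreal (gauss_mod (\<lambda>z. c * f z) z powr s) \<partial>lborel)
        = (\<integral>\<^sup>+ z. ennreal (cmod c powr s) * ennreal (gauss_mod f z powr s) \<partial>lborel)"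
      by (intro nn_integral_cong) (simp add: eq powr_mult flip: ennreal_mult)
    also have "\<dots> = ennreal (cmod c powr s) * (\<integral>\<^sup>+ z. ennreal (gauss_mod f z powr s) \<partial>lborel)"
      by (simp add: nn_integral_cmult)
    also have "\<dots> \<le> ennreal (cmod c powr s) * ennreal (2 * pi / s * M powr s)"
      using f s M real by (intro mult_left_mono) (auto simp: fock_norm_real_le_iff)
    also have "\<dots> = ennreal (2 * pi / s * (cmod c * M) powr s)"
      using s M by (simp add: powr_mult mult_ac flip: ennreal_mult)
    finally show ?thesis
      using s M real by (simp add: fock_norm_real_le_iff)
  next
    case PInf
    then show ?thesis using f M by (simp add: fock_norm_PInf_le_iff eq mult_left_mono)
  next
    case MInf
    then show ?thesis using p by simp
  qed
qed

lemma fock_norm_zero: "p \<ge> 1 \<Longrightarrow> fock_norm p (\<lambda>z. 0) = 0"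
  by (cases p) (auto simp: fock_norm_def)

lemma fock_space_cmult:
  assumes "p \<ge> 1" "f \<in> fock_space p"
  shows "(\<lambda>z. c * f z) \<in> fock_space p"
proof -
  have "fock_norm p f \<le> ennreal (enn2real (fock_norm p f))"
    using assms by (simp add: fock_space_def)
  then have "fock_norm p (\<lambda>z. c * f z) \<le> ennreal (cmod c * enn2real (fock_norm p f))"
    using assms by (intro fock_norm_cmult_le) (auto simp: fock_space_def)
  then have "fock_norm p (\<lambda>z. c * f z) < \<infinity>"
    by (rule le_less_trans) simp
  then show ?thesis
    using assms by (auto simp: fock_space_def intro: holomorphic_intros)
qed

text \<open>Provides a function on which the integration operator is visibly nonzero. The Gaussian
  is compared with the exponential kernel, whose mass is known to be finite, through the square of
  |z| - 1.\<close>

lemma one_in_fock_space: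
  assumes p: "p \<ge> 1"
  shows "(\<lambda>z. 1) \<in> fock_space p"
proof -
  have "fock_norm p (\<lambda>z. 1) < \<infinity>"
  proof (cases p)
    case (real s)
    then have s: "s \<ge> 1" using p by simp
    have "(\<integral>\<^sup>+ z. ennreal (gauss_mod (\<lambda>z. 1) z powr s) \<partial>lborel)
        \<le> (\<integral>\<^sup>+ z. ennreal (exp (1 / 2)) * ennreal (exp (- cmod z)) \<partial>lborel)"
    proof (rule nn_integral_mono)
      fix z :: complex
      have "(cmod z)\<^sup>2 / 2 * 1 \<le> (cmod z)\<^sup>2 / 2 * s" using s by (intro mult_left_mono) auto
      moreover have "(cmod z - 1)\<^sup>2 \<ge> 0" by simp
      ultimately have "- (cmod z)\<^sup>2 / 2 * s \<le> 1 / 2 - cmod z"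
        by (simp add: power2_eq_square field_simps)
      then show "ennreal (gauss_mod (\<lambda>z. 1) z powr s) \<le> ennreal (exp (1 / 2)) * ennreal (exp (- cmod z))"
        by (simp add: gauss_mod_def exp_powr_real ennreal_leI flip: ennreal_mult exp_add)
    qed
    also have "\<dots> = ennreal (exp (1 / 2)) * exp_mass"
      by (simp add: nn_integral_cmult)
    also have "\<dots> < \<infinity>" using nn_integral_exp_norm_finite by (simp add: ennreal_mult_less_top)
    finally obtain j where j: "(\<integral>\<^sup>+ z. ennreal (gauss_mod (\<lambda>z. 1) z powr s) \<partial>lborel) = ennreal j" "j \<ge> 0"
      by (cases "\<integral>\<^sup>+ z. ennreal (gauss_mod (\<lambda>z. 1) z powr s) \<partial>lborel") auto
    \<comment> \<open>This bound solves \<open>j = 2 * pi / s * M powr s\<close> for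
      \<open>M\<close>.\<close>
    have "fock_norm p (\<lambda>z. 1) \<le> ennreal ((s / (2 * pi) * j) powr (1 / s))"
      using s real j by (simp add: fock_norm_real_le_iff powr_powr)
    then show ?thesis by (rule le_less_trans) simp
  next
    case PInf
    have "fock_norm p (\<lambda>z. 1) \<le> ennreal 1"
      unfolding PInf by (subst fock_norm_PInf_le_iff) (auto simp: gauss_mod_def)
    then show ?thesis by (rule le_less_trans) simp
  next
    case MInf
    then show ?thesis using p by simp
  qed
  then show ?thesis by (simp add: fock_space_def)
qed

section \<open>Boundedness of the integration operator between Fock spaces\<close>

text \<open>Settles the target exponent infinity, and for all other targets guarantees that the
  convolution is finite.\<close>

lemma exp_conv_bounded_if_fock_norm_le:
  assumes p: "1 \<le> p" and M: "M > 0"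
  obtains D where "D \<ge> 0"
    "\<And>f z. f holomorphic_on UNIV \<Longrightarrow> fock_norm p f \<le> ennreal M \<Longrightarrow> exp_conv (gauss_mod f) z \<le> ennreal D"
proof (cases p)
  case (real s)
  then have s: "s \<ge> 1" using p by simp
  show ?thesis
  proof (rule that)
    fix f z assume "f holomorphic_on UNIV" "fock_norm p f \<le> ennreal M"
    then show "exp_conv (gauss_mod f) z \<le> ennreal ((enn2real exp_mass + 1) * (2 * pi / s * M powr s) powr (1 / s))"
      using real s M by (intro exp_conv_powr_bounds(1) borel_measurable_gauss_mod borel_measurable_entire)
        (auto simp: fock_norm_real_le_iff)
  qed simp
next
  case PInf
  show ?thesis
  proof (rule that)
    fix f z assume "f holomorphic_on UNIV" "fock_norm p f \<le> ennreal M"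
    then have "exp_conv (gauss_mod f) z \<le> ennreal M * exp_mass"
      using PInf M by (intro exp_conv_le_bound) (auto simp: fock_norm_PInf_le_iff)
    also have "\<dots> = ennreal (M * enn2real exp_mass)"
      using M nn_integral_exp_norm_finite by (simp add: ennreal_mult)
    finally show "exp_conv (gauss_mod f) z \<le> ennreal (M * enn2real exp_mass)" .
  qed (use M in simp)
next
  case MInf
  then show ?thesis using p by simp
qed

text \<open>Allowing every radius \<open>M\<close> gives both the mapping property and, at
  \<open>M = 1\<close>, the finite operator norm, with no rescaling of functions.\<close>

lemma volterra_id_fock_norm_bound:
  assumes p: "1 \<le> p" and pq: "p \<le> q" and M: "M > 0"
  obtains D where "D \<ge> 0"
    "\<And>f. f holomorphic_on UNIV \<Longrightarrow> fock_norm p f \<le> ennreal M \<Longrightarrow> fock_norm q (volterra (\<lambda>z. z) f) \<le> ennreal D"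
proof -
  let ?V = "volterra (\<lambda>z. z)"
  obtain C where C: "C > 0"
    "\<And>f z. f holomorphic_on UNIV \<Longrightarrow> ennreal (gauss_mod (?V f) z) \<le> ennreal C * exp_conv (gauss_mod f) z"
    using volterra_id_pointwise by blast
  obtain D where D: "D \<ge> 0"
    "\<And>f z. f holomorphic_on UNIV \<Longrightarrow> fock_norm p f \<le> ennreal M \<Longrightarrow> exp_conv (gauss_mod f) z \<le> ennreal D"
    by (rule exp_conv_bounded_if_fock_norm_le[OF p M]) blast
  \<comment> \<open>\<open>enn2real\<close> sends infinity to 0, so finiteness has to precede the
    passage to real numbers.\<close>
  have finite: "exp_conv (gauss_mod f) z = ennreal (enn2real (exp_conv (gauss_mod f) z))"
    if "f holomorphic_on UNIV" "fock_norm p f \<le> ennreal M" for f z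
    using D(2)[OF that, of z] by (cases "exp_conv (gauss_mod f) z") (auto simp: top_unique)
  have real_bound: "gauss_mod (?V f) z \<le> C * enn2real (exp_conv (gauss_mod f) z)"
    if "f holomorphic_on UNIV" "fock_norm p f \<le> ennreal M" for f z
  proof -
    have "ennreal (gauss_mod (?V f) z) \<le> ennreal C * ennreal (enn2real (exp_conv (gauss_mod f) z))"
      using C(2)[OF that(1), of z] finite[OF that] by metis
    then show ?thesis using C(1) by (simp flip: ennreal_mult)
  qed
  have "q \<ge> 1" using p pq by (rule order_trans)
  then consider "q = \<infinity>" | b where "q = ereal b" "b \<ge> 1" by (cases q) auto
  then show ?thesis
  proof cases
    case 1
    show ?thesis
    proof (rule that)
      fix f assume f: "f holomorphic_on UNIV" "fock_norm p f \<le> ennreal M"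
      have "gauss_mod (?V f) z \<le> C * D" for z
      proof -
        have "enn2real (exp_conv (gauss_mod f) z) \<le> D" using D f by (intro enn2real_leI) auto
        then show ?thesis using real_bound[OF f, of z] C(1) by (meson mult_left_mono less_imp_le order_trans)
      qed
      then show "fock_norm q (?V f) \<le> ennreal (C * D)"
        using 1 C(1) D(1) by (simp add: fock_norm_PInf_le_iff)
    qed (use C D in simp)
  next
    case (2 b)
    then obtain a where a: "p = ereal a" "1 \<le> a" "a \<le> b" using p pq by (cases p) auto
    \<comment> \<open>\<open>N\<close> bounds the integral of the a-th power of the weighted modulus
      when the norm is at most \<open>M\<close>; \<open>L\<close> is the resulting bound for the
      b-th power of the image.\<close>
    define N where "N = 2 * pi / a * M powr a"
    define L where "L = C powr b * (((enn2real exp_mass + 1) powr b * N powr (b / a - 1)) * (N * enn2real exp_mass))"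
    have N: "N > 0" using a M by (simp add: N_def)
    then have L: "L \<ge> 0" by (simp add: L_def)
    show ?thesis
    proof (rule that)
      fix f assume f: "f holomorphic_on UNIV" "fock_norm p f \<le> ennreal M"
      note [measurable] = borel_measurable_entire[OF f(1)]
      have "(\<integral>\<^sup>+ z. ennreal (gauss_mod (?V f) z powr b) \<partial>lborel)
          \<le> (\<integral>\<^sup>+ z. ennreal (C powr b) * ennreal (enn2real (exp_conv (gauss_mod f) z) powr b) \<partial>lborel)"
      proof (rule nn_integral_mono)
        fix z
        have "gauss_mod (?V f) z powr b \<le> (C * enn2real (exp_conv (gauss_mod f) z)) powr b"
          using real_bound[OF f] 2 by (intro powr_mono2) auto
        then show "ennreal (gauss_mod (?V f) z powr b)
            \<le> ennreal (C powr b) * ennreal (enn2real (exp_conv (gauss_mod f) z) powr b)"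
          using C(1) by (simp add: powr_mult ennreal_leI flip: ennreal_mult)
      qed
      also have "\<dots> = ennreal (C powr b) * (\<integral>\<^sup>+ z. ennreal (enn2real (exp_conv (gauss_mod f) z) powr b) \<partial>lborel)"
        by (simp add: nn_integral_cmult)
      also have "\<dots> \<le> ennreal (C powr b) * ennreal (((enn2real exp_mass + 1) powr b * N powr (b / a - 1)) * (N * enn2real exp_mass))"
        using f a M N
        by (intro mult_left_mono exp_conv_powr_bounds(2)) (auto simp: fock_norm_real_le_iff N_def)
      also have "\<dots> = ennreal L"
        using N by (simp add: L_def flip: ennreal_mult)
      also have "L = 2 * pi / b * ((b / (2 * pi) * L) powr (1 / b)) powr b"
        using 2 L by (simp add: powr_powr)
      finally show "fock_norm q (?V f) \<le> ennreal ((b / (2 * pi) * L) powr (1 / b))"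
        using 2 by (subst 2, subst fock_norm_real_le_iff) auto
    qed simp
  qed
qed

lemma bounded_volterra_id:
  assumes p: "1 \<le> p" and pq: "p \<le> q"
  shows "bounded_volterra p q (\<lambda>z. z)"
  unfolding bounded_volterra_def
proof (intro conjI ballI)
  fix f assume f: "f \<in> fock_space p"
  \<comment> \<open>Adding 1 keeps \<open>M\<close> positive when the norm of \<open>f\<close> is
    0.\<close>
  define M where "M = enn2real (fock_norm p f) + 1"
  have M: "M > 0" by (simp add: M_def add_nonneg_pos)
  have "fock_norm p f = ennreal (enn2real (fock_norm p f))"
    using f by (simp add: fock_space_def)
  also have "\<dots> \<le> ennreal M" unfolding M_def by (intro ennreal_leI) simp
  finally have "fock_norm p f \<le> ennreal M" .
  moreover obtain D where "\<And>f. f holomorphic_on UNIV \<Longrightarrow> fock_norm p f \<le> ennreal M \<Longrightarrow>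
      fock_norm q (volterra (\<lambda>z. z) f) \<le> ennreal D"
    using volterra_id_fock_norm_bound[OF p pq M] by blast
  ultimately have "fock_norm q (volterra (\<lambda>z. z) f) \<le> ennreal D"
    using f by (simp add: fock_space_def)
  then have "fock_norm q (volterra (\<lambda>z. z) f) < \<infinity>" by (rule le_less_trans) simp
  then show "volterra (\<lambda>z. z) f \<in> fock_space q"
    using f volterra_id_holomorphic by (simp add: fock_space_def)
next
  obtain D where D: "\<And>f. f holomorphic_on UNIV \<Longrightarrow> fock_norm p f \<le> ennreal 1 \<Longrightarrow>
      fock_norm q (volterra (\<lambda>z. z) f) \<le> ennreal D"
    using volterra_id_fock_norm_bound[OF p pq zero_less_one] by blast
  then have "op_norm p q (volterra (\<lambda>z. z)) \<le> ennreal D"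
    unfolding op_norm_def by (intro SUP_least) (auto simp: fock_space_def)
  then show "op_norm p q (volterra (\<lambda>z. z)) < \<infinity>" by (rule le_less_trans) simp
qed (simp add: holomorphic_intros)

section \<open>Multiples of Volterra operators and the small perturbation\<close>

lemma volterra_cmult:
  assumes "g holomorphic_on UNIV"
  shows "volterra (\<lambda>z. c * g z) f = (\<lambda>z. c * volterra g f z)"
proof
  fix z
  have "deriv (\<lambda>z. c * g z) w = c * deriv g w" for w
    using assms by (intro deriv_cmult) (auto simp: holomorphic_on_def)
  then have "volterra (\<lambda>z. c * g z) f z = integral {0..1} (\<lambda>x. c * (f (linepath 0 z x) * deriv g (linepath 0 z x) * z))"
    by (simp add: volterra_def contour_integral_integral mult_ac)
  \<comment> \<open>The factor leaves the integral also when the integrand is not integrable, since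
    both sides are then 0.\<close>
  then show "volterra (\<lambda>z. c * g z) f z = c * volterra g f z"
    by (simp add: volterra_def contour_integral_integral)
qed

lemma fock_norm_cmult_volterra_le:
  assumes q: "1 \<le> q" and h: "bounded_volterra p q h"
    and f: "f \<in> fock_space p" "fock_norm p f \<le> 1"
  shows "fock_norm q (\<lambda>z. c * volterra h f z) \<le> ennreal (cmod c * enn2real (op_norm p q (volterra h)))"
proof (rule fock_norm_cmult_le[OF q])
  have "fock_norm q (volterra h f) \<le> op_norm p q (volterra h)"
    unfolding op_norm_def using f by (intro SUP_upper) auto
  also have "\<dots> = ennreal (enn2real (op_norm p q (volterra h)))"
    using h by (simp add: bounded_volterra_def)
  finally show "fock_norm q (volterra h f) \<le> ennreal (enn2real (op_norm p q (volterra h)))" .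
qed (use h f in \<open>auto simp: bounded_volterra_def fock_space_def\<close>)

lemma bounded_volterra_cmult:
  assumes "1 \<le> q" and h: "bounded_volterra p q h"
  shows "bounded_volterra p q (\<lambda>z. c * h z)"
proof -
  have hol: "h holomorphic_on UNIV" using h by (simp add: bounded_volterra_def)
  have "op_norm p q (volterra (\<lambda>z. c * h z)) \<le> ennreal (cmod c * enn2real (op_norm p q (volterra h)))"
    unfolding op_norm_def[of p q "volterra (\<lambda>z. c * h z)"] volterra_cmult[OF hol]
    by (intro SUP_least) (auto intro!: fock_norm_cmult_volterra_le assms)
  then have "op_norm p q (volterra (\<lambda>z. c * h z)) < \<infinity>" by (rule le_less_trans) simp
  then show ?thesis
    using assms hol unfolding bounded_volterra_def
    by (auto simp: volterra_cmult intro!: fock_space_cmult holomorphic_intros)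
qed

lemma compact_op_zero:
  assumes "1 \<le> q"
  shows "compact_op p q (\<lambda>f z. 0)"
proof -
  have "(\<lambda>z. 0) \<in> fock_space q" using assms by (simp add: fock_space_def fock_norm_zero)
  then show ?thesis
    using assms by (auto simp: compact_op_def linear_on_fock_def fock_norm_zero strict_mono_def
        intro!: bexI[of _ "\<lambda>z. 0"] exI[of _ id])
qed

lemma volterra_id_nonzero:
  assumes "1 \<le> p" "p \<le> q"
  shows "\<exists>f \<in> fock_space p. volterra (\<lambda>z. z) f \<noteq> (\<lambda>z. 0)"
proof
  show "(\<lambda>z. 1) \<in> fock_space p" using assms by (intro one_in_fock_space)
  have "volterra (\<lambda>z. z) (\<lambda>z. 1) 1 = 1" by (simp add: volterra_id_integral)
  then show "volterra (\<lambda>z. z) (\<lambda>z. 1) \<noteq> (\<lambda>z. 0)" by (metis zero_neq_one)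
qed

theorem theorem2p5:
  fixes p q :: ereal and g :: "complex \<Rightarrow> complex" and r :: real
  assumes "1 \<le> p" and "p \<le> q"
    and "bounded_volterra p q g"
    and "r > 0"
  shows "\<exists>g1. bounded_volterra p q g1 \<and>
           (\<exists>f \<in> fock_space p. volterra g1 f \<noteq> volterra g f) \<and>
           ess_norm p q (\<lambda>f z. volterra g f z - volterra g1 f z) < ennreal r"
proof -
  have q: "1 \<le> q" using assms(1,2) by (rule order_trans)
  \<comment> \<open>Common end of both cases: \<open>h\<close> is the symbol of the perturbing
    operator. The scalar stays universally quantified because its size depends on the norm of that
    operator, and the equation is restricted to \<open>fock_space p\<close> because in the second
    case the operator with symbol \<open>g\<close> is known to vanish only there.\<close>
  have step: ?thesis
    if h: "bounded_volterra p q h" "\<exists>f \<in> fock_space p. volterra h f \<noteq> (\<lambda>z. 0)"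
      and perturb: "\<And>c. \<exists>g1. bounded_volterra p q g1 \<and>
        (\<forall>f \<in> fock_space p. volterra g1 f = (\<lambda>z. volterra g f z + c * volterra h f z))" for h
  proof -
    define N where "N = enn2real (op_norm p q (volterra h))"
    \<comment> \<open>The summand 1 avoids division by 0 when \<open>N = 0\<close>; the factor 2
      keeps |c| N strictly below \<open>r\<close>.\<close>
    define c where "c = complex_of_real (r / (2 * (N + 1)))"
    have N: "N \<ge> 0" by (simp add: N_def)
    then have cnorm: "cmod c = r / (2 * (N + 1))"
      unfolding c_def norm_of_real using assms(4) by simp
    then have "c \<noteq> 0" using N assms(4) by auto
    have "r * N < 2 * (r * (N + 1))" using N assms(4) by (simp add: algebra_simps add_nonneg_pos)
    then have cN: "cmod (- c) * N < r"
      using N by (simp add: cnorm field_simps)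
    obtain g1 where g1: "bounded_volterra p q g1"
      "\<And>f. f \<in> fock_space p \<Longrightarrow> volterra g1 f = (\<lambda>z. volterra g f z + c * volterra h f z)"
      using perturb by blast
    have "\<exists>f \<in> fock_space p. volterra g1 f \<noteq> volterra g f"
      using h(2) g1(2) \<open>c \<noteq> 0\<close> by (force simp: fun_eq_iff)
    moreover have "ess_norm p q (\<lambda>f z. volterra g f z - volterra g1 f z) < ennreal r"
    proof -
      have "ess_norm p q (\<lambda>f z. volterra g f z - volterra g1 f z)
          \<le> op_norm p q (\<lambda>f z. volterra g f z - volterra g1 f z - 0)"
        unfolding ess_norm_def using compact_op_zero[OF q] by (intro INF_lower) simp
      also have "\<dots> \<le> ennreal (cmod (- c) * N)"
        unfolding op_norm_def
      proof (rule SUP_least)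
        fix f assume "f \<in> {f \<in> fock_space p. fock_norm p f \<le> 1}"
        then have f: "f \<in> fock_space p" "fock_norm p f \<le> 1" by auto
        show "fock_norm q (\<lambda>z. volterra g f z - volterra g1 f z - 0) \<le> ennreal (cmod (- c) * N)"
          using fock_norm_cmult_volterra_le[OF q h(1) f, of "- c"] by (simp add: g1(2)[OF f(1)] N_def)
      qed
      also have "\<dots> < ennreal r" using cN assms(4) by (simp add: ennreal_lessI)
      finally show ?thesis .
    qed
    ultimately show ?thesis using g1(1) by blast
  qed
  show ?thesis
  proof (cases "\<exists>f \<in> fock_space p. volterra g f \<noteq> (\<lambda>z. 0)")
    case True
    \<comment> \<open>The perturbation rescales the symbol itself, so its boundedness is inherited
      from that of \<open>g\<close>.\<close>
    have "volterra (\<lambda>z. (1 + c) * g z) f = (\<lambda>z. volterra g f z + c * volterra g f z)" for c f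
      using assms(3) by (subst volterra_cmult) (auto simp: bounded_volterra_def distrib_right)
    then show ?thesis
      using bounded_volterra_cmult[OF q assms(3)] by (intro step[OF assms(3) True]) blast
  next
    case False
    let ?id = "\<lambda>z::complex. z"
    have id: "bounded_volterra p q ?id" by (rule bounded_volterra_id[OF assms(1,2)])
    \<comment> \<open>As the operator with symbol \<open>g\<close> is zero on the space, the
      perturbed operator is just the multiple of integration.\<close>
    have "volterra (\<lambda>z. c * z) f = (\<lambda>z. volterra g f z + c * volterra ?id f z)" if "f \<in> fock_space p" for c f
      using False that by (subst volterra_cmult) (auto simp: holomorphic_intros)
    then show ?thesis
      using bounded_volterra_cmult[OF q id]
      by (intro step[OF id volterra_id_nonzero[OF assms(1,2)]]) blast
  qed
qed

end
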